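(* Let $\tau>0$, $M\in\mathbb{N}$, $\epsilon<1$ and $\alpha\ge1$, let $\mathscr{T}_h$ be a triangulation of $\Omega$ of any mesh size $h>0$, let $\phi_h^0=P_h\phi_0$, and for $1\le m\le M$ let $(\phi_h^m,\mu_h^m)\in Z_h\times V_h$ be a solution of $$(\delta_\tau\phi_h^m,\nu_h)+(\nabla\mu_h^m,\nabla\nu_h)=0\quad\forall\,\nu_h\in V_h,$$ $$a_h^{IP}(\phi_h^m,\psi_h)+\big((\phi_h^m)^3+(1-\epsilon)\phi_h^m,\psi_h\big)-2(\nabla\phi_h^{m-1},\nabla\psi_h)-(\mu_h^m,\psi_h)=0\quad\forall\,\psi_h\in Z_h.$$ Define the discrete energy $$F(\phi):=\frac14\|\phi\|_{L^4}^4+\frac{1-\epsilon}{2}\|\phi\|_{L^2}^2-\|\nabla\phi\|_{L^2}^2+\frac12a_h^{IP}(\phi,\phi).$$ Then for all $1\le\ell\le M$ (and any $h,\tau>0$), $$F(\phi_h^\ell)+\tau\sum_{m=1}^\ell\|\nabla\mu_h^m\|_{L^2}^2+\tau^2\sum_{m=1}^\ell\Big\{\frac{1-\epsilon}{2}\|\delta_\tau\phi_h^m\|_{L^2}^2+\|\nabla\delta_\tau\phi_h^m\|_{L^2}^2+\frac14\|\delta_\tau(\phi_h^m)^2\|_{L^2}^2+\frac12\|\phi_h^m\delta_\tau\phi_h^m\|_{L^2}^2+\frac12a_h^{IP}(\delta_\tau\phi_h^m,\delta_\tau\phi_h^m)\Big\}=F(\phi_h^0).$$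
   Context: $\Omega\subset\mathbb{R}^2$ is a bounded open polygonal domain; $(\cdot,\cdot)$ is the $L^2(\Omega)$ inner product and $\|\cdot\|_{L^p}$ is the norm of $L^p(\Omega)$. $\mathscr{T}_h$ is a geometrically conforming, locally quasi-uniform simplicial triangulation of $\Omega$, $h=\max_{K\in\mathscr{T}_h}\operatorname{diam}K$, $\mathscr{E}_h$ is the set of edges of the triangles, $|e|$ is the length of an edge $e$. $V_h=\{v\in C(\overline\Omega): v|_K\in P_1(K)\ \forall K\in\mathscr{T}_h\}$, $Z_h=\{v\in C(\overline\Omega): v|_K\in P_2(K)\ \forall K\in\mathscr{T}_h\}$. For a sequence $(a^m)$, $\delta_\tau a^m:=(a^m-a^{m-1})/\tau$; in particular $\delta_\tau(\phi_h^m)^2=((\phi_h^m)^2-(\phi_h^{m-1})^2)/\tau$. For an interior edge $e$ shared by triangles $K_\pm$, with unit normal $n_e$ pointing from $K_-$ to $K_+$ and $v_\pm=v|_{K_\pm}$, set $[\![\partial v/\partial n_e]\!]=n_e\cdot(\nabla v_+-\nabla v_-)$ and $\{\!\{\partial^2v/\partial n_e^2\}\!\}=\frac12\big(\partial^2v_-/\partial n_e^2+\partial^2v_+/\partial n_e^2\big)$, where $\partial^2u/\partial n_e^2=n_e\cdot(\nabla^2u)n_e$. For a boundary edge, with $n_e$ the outward unit normal to $\Omega$, set $[\![\partial v/\partial n_e]\!]=-n_e\cdot\nabla v$ and $\{\!\{\partial^2v/\partial n_e^2\}\!\}=n_e\cdot(\nabla^2v)n_e$. With penalty parameter $\alpha\ge1$,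 $$a_h^{IP}(w,v)=\sum_{K\in\mathscr{T}_h}\int_K\nabla^2w:\nabla^2v\,dx+\sum_{e\in\mathscr{E}_h}\int_e\Big\{\!\!\Big\{\frac{\partial^2w}{\partial n_e^2}\Big\}\!\!\Big\}\Big[\!\!\Big[\frac{\partial v}{\partial n_e}\Big]\!\!\Big]dS+\sum_{e\in\mathscr{E}_h}\int_e\Big\{\!\!\Big\{\frac{\partial^2v}{\partial n_e^2}\Big\}\!\!\Big\}\Big[\!\!\Big[\frac{\partial w}{\partial n_e}\Big]\!\!\Big]dS+\alpha\sum_{e\in\mathscr{E}_h}\frac1{|e|}\int_e\Big[\!\!\Big[\frac{\partial w}{\partial n_e}\Big]\!\!\Big]\Big[\!\!\Big[\frac{\partial v}{\partial n_e}\Big]\!\!\Big]dS.$$ The initial datum $\phi_0\in H^4(\Omega)$ satisfies $\mathbf{n}\cdot\nabla\phi_0=0$ and $\mathbf{n}\cdot\nabla\Delta\phi_0=0$ on $\partial\Omega$, and $P_h\phi_0\in Z_h$ is its Ritz projection: $a_h^{IP}(P_h\phi_0-\phi_0,\xi)+(1-\epsilon)(P_h\phi_0-\phi_0,\xi)=0$ for all $\xi\in Z_h$, and $(P_h\phi_0-\phi_0,1)=0$. *)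

theory Defs
  imports "HOL-Analysis.Analysis"
begin

definition partial :: "2 \<Rightarrow> (real^2 \<Rightarrow> real) \<Rightarrow> real^2 \<Rightarrow> real" where
  "partial i v x = frechet_derivative v (at x) (axis i 1)"

definition grad :: "(real^2 \<Rightarrow> real) \<Rightarrow> real^2 \<Rightarrow> real^2" where
  "grad v x = (\<chi> i. partial i v x)"

definition hess :: "(real^2 \<Rightarrow> real) \<Rightarrow> real^2 \<Rightarrow> real^2^2" where
  "hess v x = (\<chi> i j. partial j (partial i v) x)"

definition laplacian :: "(real^2 \<Rightarrow> real) \<Rightarrow> real^2 \<Rightarrow> real" where
  "laplacian v x = (\<Sum>i\<in>UNIV. hess v x $ i $ i)"

text \<open>A multi-index is written as the list of the coordinate directions of differentiation, so its
  order is the length of the list.\<close>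

definition partials :: "2 list \<Rightarrow> (real^2 \<Rightarrow> real) \<Rightarrow> real^2 \<Rightarrow> real" where
  "partials is v = foldr partial is v"

definition smooth :: "(real^2 \<Rightarrow> real) \<Rightarrow> bool" where
  "smooth v \<longleftrightarrow> (\<forall>is x. partials is v differentiable (at x))"

definition L2_set_on :: "'a::euclidean_space set \<Rightarrow> ('a \<Rightarrow> real) set" where
  "L2_set_on S = {u. set_borel_measurable lebesgue S u \<and> set_integrable lebesgue S (\<lambda>x. (u x)\<^sup>2)}"

definition L2_inner :: "(real^2) set \<Rightarrow> (real^2 \<Rightarrow> 'b::euclidean_space) \<Rightarrow> (real^2 \<Rightarrow> 'b) \<Rightarrow> real" where
  "L2_inner S u v = (LINT x:S|lebesgue. u x \<bullet> v x)"

definition Lp_norm :: "real \<Rightarrow> (real^2) set \<Rightarrow> (real^2 \<Rightarrow> 'b::euclidean_space) \<Rightarrow> real" where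
  "Lp_norm p S u = (LINT x:S|lebesgue. norm (u x) powr p) powr (1 / p)"

definition test_function :: "(real^2) set \<Rightarrow> (real^2 \<Rightarrow> real) \<Rightarrow> bool" where
  "test_function U \<psi> \<longleftrightarrow> smooth \<psi> \<and> (\<exists>C. compact C \<and> C \<subseteq> U \<and> (\<forall>x. x \<notin> C \<longrightarrow> \<psi> x = 0))"

definition weak_deriv :: "(real^2) set \<Rightarrow> 2 list \<Rightarrow> (real^2 \<Rightarrow> real) \<Rightarrow> (real^2 \<Rightarrow> real) \<Rightarrow> bool" where
  "weak_deriv U is u g \<longleftrightarrow> u \<in> L2_set_on U \<and> g \<in> L2_set_on U \<and>
     (\<forall>\<psi>. test_function U \<psi> \<longrightarrow>
        L2_inner U u (partials is \<psi>) = (- 1) ^ length is * L2_inner U g \<psi>)"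

definition sobolev_H :: "nat \<Rightarrow> (real^2) set \<Rightarrow> (real^2 \<Rightarrow> real) set" where
  "sobolev_H k U = {u. u \<in> L2_set_on U \<and> (\<forall>is. length is \<le> k \<longrightarrow> (\<exists>g. weak_deriv U is u g))}"

text \<open>\<open>t\<close> is the trace of \<open>u \<in> H\<^sup>1(D)\<close> on the segment from \<open>a\<close> to \<open>b\<close>, a part of the boundary of
  \<open>D\<close>: the \<open>L\<^sup>2\<close>-limit of the restrictions of smooth functions that converge to \<open>u\<close> in \<open>H\<^sup>1(D)\<close>.
  It is used only for convex \<open>D\<close>, where such functions are dense in \<open>H\<^sup>1(D)\<close>.\<close>

definition is_trace ::
    "(real^2) set \<Rightarrow> real^2 \<Rightarrow> real^2 \<Rightarrow> (real^2 \<Rightarrow> real) \<Rightarrow> (real^2 \<Rightarrow> real) \<Rightarrow> bool" where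
  "is_trace D a b u t \<longleftrightarrow>
     (\<lambda>s. t (linepath a b s)) \<in> L2_set_on {0..1} \<and>
     (\<exists>G w. (\<forall>i. weak_deriv D [i] u (G i)) \<and>
        (\<forall>k::nat. smooth (w k)) \<and>
        (\<lambda>k. LINT x:D|lebesgue. (w k x - u x)\<^sup>2) \<longlonglongrightarrow> 0 \<and>
        (\<forall>i. (\<lambda>k. LINT x:D|lebesgue. (partial i (w k) x - G i x)\<^sup>2) \<longlonglongrightarrow> 0) \<and>
        (\<lambda>k. LINT s:{0..1}|lebesgue. (w k (linepath a b s) - t (linepath a b s))\<^sup>2) \<longlonglongrightarrow> 0)"

text \<open>\<open>n \<cdot> \<nabla>u = 0\<close> on \<open>\<partial>\<Omega>\<close> in the sense of traces, for \<open>u \<in> H\<^sup>2(\<Omega>)\<close>. Every point \<open>x\<close> of the boundary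
  of a polygonal domain other than a vertex has a radius \<open>r\<close> for which \<open>\<Omega> \<inter> ball x r\<close> is a half-disc
  with outward unit normal \<open>n\<close>; the normal component of the weak gradient has to vanish on the
  diameters of all these half-discs.\<close>

definition neumann_zero :: "(real^2) set \<Rightarrow> (real^2 \<Rightarrow> real) \<Rightarrow> bool" where
  "neumann_zero \<Omega> u \<longleftrightarrow>
     (\<exists>G. (\<forall>i. weak_deriv \<Omega> [i] u (\<lambda>x. G x $ i)) \<and>
        (\<forall>x n p r. r > 0 \<and> norm n = 1 \<and> norm p = 1 \<and> n \<bullet> p = 0 \<and>
             \<Omega> \<inter> ball x r = {y \<in> ball x r. n \<bullet> (y - x) < 0} \<longrightarrow>
           is_trace (\<Omega> \<inter> ball x r) (x - r *\<^sub>R p) (x + r *\<^sub>R p) (\<lambda>y. n \<bullet> G y) (\<lambda>_. 0)))"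

text \<open>The condition \<open>\<Omega> = interior (closure \<Omega>)\<close> excludes slits: \<open>\<Omega>\<close> lies on one side of each of its
  sides. Holes and reentrant corners are allowed.\<close>

definition polygonal_domain :: "(real^2) set \<Rightarrow> bool" where
  "polygonal_domain \<Omega> \<longleftrightarrow> \<Omega> \<noteq> {} \<and> open \<Omega> \<and> connected \<Omega> \<and> bounded \<Omega> \<and> \<Omega> = interior (closure \<Omega>) \<and>
     (\<exists>S. finite S \<and> frontier \<Omega> = (\<Union>(a, b)\<in>S. closed_segment a b))"

text \<open>Geometric conformity, i.e. that two triangles meet in a common face or not at all, is part of
  \<^const>\<open>triangulation\<close>.\<close>

definition mesh_of :: "(real^2) set \<Rightarrow> (real^2) set set \<Rightarrow> bool" where
  "mesh_of \<Omega> \<T> \<longleftrightarrow> triangulation \<T> \<and> (\<forall>K\<in>\<T>. 2 simplex K) \<and> \<Union>\<T> = closure \<Omega>"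

definition locally_quasi_uniform :: "real \<Rightarrow> (real^2) set set \<Rightarrow> bool" where
  "locally_quasi_uniform \<sigma> \<T> \<longleftrightarrow>
     (\<forall>K\<in>\<T>. \<forall>K'\<in>\<T>. K \<inter> K' \<noteq> {} \<longrightarrow> diameter K \<le> \<sigma> * diameter K')"

definition mesh_size :: "(real^2) set set \<Rightarrow> real" where
  "mesh_size \<T> = Max (diameter ` \<T>)"

definition edges :: "(real^2) set set \<Rightarrow> (real^2) set set" where
  "edges \<T> = {e. \<exists>K\<in>\<T>. e edge_of K}"

definition poly_on :: "nat \<Rightarrow> (real^2) set \<Rightarrow> (real^2 \<Rightarrow> real) \<Rightarrow> bool" where
  "poly_on k K v \<longleftrightarrow>
     (\<exists>c :: nat \<Rightarrow> nat \<Rightarrow> real. \<forall>x\<in>K. v x = (\<Sum>i\<le>k. \<Sum>j\<le>k - i. c i j * (x $ 1) ^ i * (x $ 2) ^ j))"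

text \<open>Members of the finite element spaces are total functions whose values outside \<open>closure \<Omega>\<close> are
  irrelevant.\<close>

definition fe_space :: "nat \<Rightarrow> (real^2) set \<Rightarrow> (real^2) set set \<Rightarrow> (real^2 \<Rightarrow> real) set" where
  "fe_space k \<Omega> \<T> = {v. continuous_on (closure \<Omega>) v \<and> (\<forall>K\<in>\<T>. poly_on k K v)}"

definition V_space :: "(real^2) set \<Rightarrow> (real^2) set set \<Rightarrow> (real^2 \<Rightarrow> real) set" where
  "V_space = fe_space 1"

definition Z_space :: "(real^2) set \<Rightarrow> (real^2) set set \<Rightarrow> (real^2 \<Rightarrow> real) set" where
  "Z_space = fe_space 2"

definition interior_edge :: "(real^2) set set \<Rightarrow> (real^2) set \<Rightarrow> bool" where
  "interior_edge \<T> e \<longleftrightarrow> (\<exists>K\<in>\<T>. \<exists>K'\<in>\<T>. K \<noteq> K' \<and> e edge_of K \<and> e edge_of K')"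

text \<open>\<open>K_minus\<close> is a triangle with edge \<open>e\<close>, and \<open>K_plus\<close> the other one if \<open>e\<close> is an interior edge.
  The bilinear form does not depend on which of the two triangles is selected as \<open>K_minus\<close>, since
  exchanging them also reverses \<open>n_e\<close>.\<close>

definition K_minus :: "(real^2) set set \<Rightarrow> (real^2) set \<Rightarrow> (real^2) set" where
  "K_minus \<T> e = (SOME K. K \<in> \<T> \<and> e edge_of K)"

definition K_plus :: "(real^2) set set \<Rightarrow> (real^2) set \<Rightarrow> (real^2) set" where
  "K_plus \<T> e = (SOME K. K \<in> \<T> \<and> e edge_of K \<and> K \<noteq> K_minus \<T> e)"

text \<open>The unit normal on \<open>e\<close> pointing out of \<open>K_minus\<close>; on a boundary edge it is therefore the outward
  unit normal to \<open>\<Omega>\<close>.\<close>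

definition edge_normal :: "(real^2) set set \<Rightarrow> (real^2) set \<Rightarrow> real^2" where
  "edge_normal \<T> e = (THE n. norm n = 1 \<and> (\<forall>x\<in>e. \<forall>y\<in>K_minus \<T> e. n \<bullet> (y - x) \<le> 0))"

text \<open>One-sided value on the boundary of \<open>K\<close> of a function that is continuous up to the boundary
  from inside \<open>K\<close>.\<close>

definition side_value :: "(real^2) set \<Rightarrow> (real^2 \<Rightarrow> 'b::t2_space) \<Rightarrow> real^2 \<Rightarrow> 'b" where
  "side_value K g x = Lim (at x within interior K) g"

definition jump_dn :: "(real^2) set set \<Rightarrow> (real^2) set \<Rightarrow> (real^2 \<Rightarrow> real) \<Rightarrow> real^2 \<Rightarrow> real" where
  "jump_dn \<T> e v x =
     (let n = edge_normal \<T> e in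
      if interior_edge \<T> e
      then n \<bullet> (side_value (K_plus \<T> e) (grad v) x - side_value (K_minus \<T> e) (grad v) x)
      else - (n \<bullet> side_value (K_minus \<T> e) (grad v) x))"

definition avg_dnn :: "(real^2) set set \<Rightarrow> (real^2) set \<Rightarrow> (real^2 \<Rightarrow> real) \<Rightarrow> real^2 \<Rightarrow> real" where
  "avg_dnn \<T> e v x =
     (let n = edge_normal \<T> e in
      if interior_edge \<T> e
      then (n \<bullet> (side_value (K_minus \<T> e) (hess v) x *v n) +
            n \<bullet> (side_value (K_plus \<T> e) (hess v) x *v n)) / 2
      else n \<bullet> (side_value (K_minus \<T> e) (hess v) x *v n))"

text \<open>Integration over an edge with respect to arc length; the result does not depend on the order
  in which the endpoints are selected.\<close>

definition edge_integral :: "(real^2) set \<Rightarrow> (real^2 \<Rightarrow> real) \<Rightarrow> real" where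
  "edge_integral e f =
     (let (a, b) = (SOME (a, b). e = closed_segment a b)
      in norm (b - a) * (LINT s:{0..1}|lebesgue. f (linepath a b s)))"

text \<open>The derivatives in the form are classical derivatives in the interior of each triangle. This also
  covers an argument from \<open>H\<^sup>4(\<Omega>)\<close> if it is given by its continuous representative, which by Sobolev's
  embedding theorem is \<open>C\<^sup>2\<close> up to the boundary of each triangle. The inner product of \<^typ>\<open>real^2^2\<close> is the Frobenius product, and the length of an edge is its diameter.\<close>

definition a_IP :: "real \<Rightarrow> (real^2) set set \<Rightarrow> (real^2 \<Rightarrow> real) \<Rightarrow> (real^2 \<Rightarrow> real) \<Rightarrow> real" where
  "a_IP \<alpha> \<T> w v =
     (\<Sum>K\<in>\<T>. LINT x:K|lebesgue. hess w x \<bullet> hess v x)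
     + (\<Sum>e\<in>edges \<T>. edge_integral e (\<lambda>x. avg_dnn \<T> e w x * jump_dn \<T> e v x))
     + (\<Sum>e\<in>edges \<T>. edge_integral e (\<lambda>x. avg_dnn \<T> e v x * jump_dn \<T> e w x))
     + \<alpha> * (\<Sum>e\<in>edges \<T>. 1 / diameter e * edge_integral e (\<lambda>x. jump_dn \<T> e w x * jump_dn \<T> e v x))"

definition ritz_projection ::
    "real \<Rightarrow> real \<Rightarrow> (real^2) set \<Rightarrow> (real^2) set set \<Rightarrow> (real^2 \<Rightarrow> real) \<Rightarrow> (real^2 \<Rightarrow> real) \<Rightarrow> bool" where
  "ritz_projection \<alpha> \<epsilon> \<Omega> \<T> u p \<longleftrightarrow> p \<in> Z_space \<Omega> \<T> \<and>
     (\<forall>\<xi>\<in>Z_space \<Omega> \<T>.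
        a_IP \<alpha> \<T> (\<lambda>x. p x - u x) \<xi> + (1 - \<epsilon>) * L2_inner \<Omega> (\<lambda>x. p x - u x) \<xi> = 0) \<and>
     L2_inner \<Omega> (\<lambda>x. p x - u x) (\<lambda>x. 1) = 0"

definition \<delta> :: "real \<Rightarrow> (nat \<Rightarrow> real^2 \<Rightarrow> real) \<Rightarrow> nat \<Rightarrow> real^2 \<Rightarrow> real" where
  "\<delta> \<tau> a m x = (a m x - a (m - 1) x) / \<tau>"

definition energy :: "real \<Rightarrow> real \<Rightarrow> (real^2) set \<Rightarrow> (real^2) set set \<Rightarrow> (real^2 \<Rightarrow> real) \<Rightarrow> real" where
  "energy \<alpha> \<epsilon> \<Omega> \<T> u =
     1/4 * Lp_norm 4 \<Omega> u ^ 4 + (1 - \<epsilon>) / 2 * (Lp_norm 2 \<Omega> u)\<^sup>2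
     - (Lp_norm 2 \<Omega> (grad u))\<^sup>2 + 1/2 * a_IP \<alpha> \<T> u u"

end

theory Submission
  imports Defs
begin

text \<open>
  The scheme is tested with the natural choices. Write \<open>u = \<phi>\<^sub>h\<^sup>m\<close>, \<open>v = \<phi>\<^sub>h\<^sup>m\<^sup>-\<^sup>1\<close>, \<open>d = (u - v) / \<tau>\<close>.
  Taking \<open>\<nu>\<^sub>h = \<mu>\<^sub>h\<^sup>m\<close> in the first equation and \<open>\<psi>\<^sub>h = d\<close> in the second, the two occurrences of
  \<open>(\<mu>\<^sub>h\<^sup>m, d)\<close> cancel and leave \<open>\<parallel>\<nabla>\<mu>\<^sub>h\<^sup>m\<parallel>\<^sup>2\<close>. Every other term is rewritten, after multiplication by \<open>\<tau>\<close>,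
  as an increment of a part of the energy plus a remainder built from differences, by three identities:

  \<^item> \<open>B(u, u - v) = (B(u, u) - B(v, v) + B(u - v, u - v)) / 2\<close> for a symmetric bilinear form \<open>B\<close>; it
    serves the penalty form and the \<open>L\<^sup>2\<close> product;
  \<^item> \<open>- 2 B(v, u - v) = - B(u, u) + B(v, v) + B(u - v, u - v)\<close>; the explicit treatment of the concave
    gradient term is what gives its dissipation the favourable sign;
  \<^item> \<open>u\<^sup>3(u - v) = (u\<^sup>4 - v\<^sup>4) / 4 + (u\<^sup>2 - v\<^sup>2)\<^sup>2 / 4 + u\<^sup>2(u - v)\<^sup>2 / 2\<close>, integrated over the domain.

  This gives the energy balance of one time step (\<open>energy_step\<close>), and the sum over the steps
  telescopes.

  The analytic content is that the forms really are bilinear on the finite element space, although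
  they are built from integrals, classical derivatives and one-sided limits, each of which is additive
  only when it exists. Derivatives of a piecewise polynomial may fail to exist on the edges, but in the
  interior of each triangle they agree with polynomials, which extend continuously to the closed
  triangle (\<open>pw_extendable\<close>). Hence their products are integrable, the edges being null sets, and their
  one-sided values on the edges exist and are continuous. From this follow
  \<open>L2_inner_combination\<close>, \<open>L2_inner_grad_combination\<close> and \<open>a_IP_combination\<close>.
\<close>

section \<open>Piecewise polynomials and their derivatives\<close>

definition pw_poly :: "(real^2) set set \<Rightarrow> (real^2 \<Rightarrow> real) \<Rightarrow> bool" where
  "pw_poly \<T> v \<longleftrightarrow> (\<forall>K\<in>\<T>. \<exists>p. real_polynomial_function p \<and> (\<forall>x\<in>K. v x = p x))"

text \<open>Nothing is asked on the boundaries of the triangles, where a derivative of a piecewise polynomial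
  need not exist. The extensions to \<open>K\<close> from the interiors of different triangles are independent.\<close>
definition pw_extendable :: "(real^2) set set \<Rightarrow> (real^2 \<Rightarrow> 'b::topological_space) \<Rightarrow> bool" where
  "pw_extendable \<T> f \<longleftrightarrow> (\<forall>K\<in>\<T>. \<exists>g. continuous_on K g \<and> (\<forall>x\<in>interior K. f x = g x))"

lemma pw_poly_fe_space:
  assumes "v \<in> fe_space k \<Omega> \<T>" shows "pw_poly \<T> v"
  unfolding pw_poly_def
proof
  fix K assume "K \<in> \<T>"
  then obtain c :: "nat \<Rightarrow> nat \<Rightarrow> real" where
    c: "\<forall>x\<in>K. v x = (\<Sum>i\<le>k. \<Sum>j\<le>k - i. c i j * (x $ 1) ^ i * (x $ 2) ^ j)"
    using assms unfolding fe_space_def poly_on_def by blast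
  have "real_polynomial_function (\<lambda>x::real^2. x $ n)" for n
    by (rule real_polynomial_function.intros(1)) (rule bounded_linear_vec_nth)
  then have "real_polynomial_function
      (\<lambda>x::real^2. \<Sum>i\<le>k. \<Sum>j\<le>k - i. c i j * (x $ 1) ^ i * (x $ 2) ^ j)"
    by (intro real_polynomial_function_sum real_polynomial_function.intros(4)
        real_polynomial_function.intros(2) real_polynomial_function_power) auto
  with c show "\<exists>p. real_polynomial_function p \<and> (\<forall>x\<in>K. v x = p x)"
    by blast
qed

lemma pw_poly_combination:
  assumes "pw_poly \<T> u" "pw_poly \<T> v"
  shows "pw_poly \<T> (\<lambda>x. c * u x + d * v x)"
  unfolding pw_poly_def
proof
  fix K assume K: "K \<in> \<T>"
  obtain p where p: "real_polynomial_function p" "\<forall>x\<in>K. u x = p x"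
    using assms(1) K unfolding pw_poly_def by blast
  obtain q where q: "real_polynomial_function q" "\<forall>x\<in>K. v x = q x"
    using assms(2) K unfolding pw_poly_def by blast
  have "real_polynomial_function (\<lambda>x. c * p x + d * q x)"
    using p q by (intro real_polynomial_function.intros(2-4))
  then show "\<exists>r. real_polynomial_function r \<and> (\<forall>x\<in>K. c * u x + d * v x = r x)"
    using p q by (intro exI[of _ "\<lambda>x. c * p x + d * q x"]) auto
qed

lemma pw_extendable_map2:
  assumes "pw_extendable \<T> f" "pw_extendable \<T> g"
    and "continuous_on UNIV (\<lambda>z. H (fst z) (snd z))"
  shows "pw_extendable \<T> (\<lambda>x. H (f x) (g x))"
  unfolding pw_extendable_def
proof
  fix K assume K: "K \<in> \<T>"
  obtain f' where f': "continuous_on K f'" "\<forall>x\<in>interior K. f x = f' x"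
    using assms(1) K unfolding pw_extendable_def by blast
  obtain g' where g': "continuous_on K g'" "\<forall>x\<in>interior K. g x = g' x"
    using assms(2) K unfolding pw_extendable_def by blast
  have "continuous_on K (\<lambda>x. H (fst (f' x, g' x)) (snd (f' x, g' x)))"
    by (rule continuous_on_compose2[OF assms(3)]) (use f' g' in \<open>auto intro!: continuous_intros\<close>)
  then show "\<exists>h. continuous_on K h \<and> (\<forall>x\<in>interior K. H (f x) (g x) = h x)"
    using f' g' by (intro exI[of _ "\<lambda>x. H (f' x) (g' x)"]) auto
qed

lemma pw_extendable_add:
  fixes f g :: "real^2 \<Rightarrow> 'b::real_normed_vector"
  assumes "pw_extendable \<T> f" "pw_extendable \<T> g"
  shows "pw_extendable \<T> (\<lambda>x. f x + g x)"
  by (rule pw_extendable_map2[OF assms]) (intro continuous_intros)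

lemma pw_extendable_scaleR:
  fixes f :: "real^2 \<Rightarrow> 'b::real_normed_vector"
  assumes "pw_extendable \<T> f"
  shows "pw_extendable \<T> (\<lambda>x. c *\<^sub>R f x)"
  by (rule pw_extendable_map2[OF assms assms, of "\<lambda>a b. c *\<^sub>R a"]) (intro continuous_intros)

lemma pw_extendable_inner:
  fixes f g :: "real^2 \<Rightarrow> 'b::real_inner"
  assumes "pw_extendable \<T> f" "pw_extendable \<T> g"
  shows "pw_extendable \<T> (\<lambda>x. f x \<bullet> g x)"
  by (rule pw_extendable_map2[OF assms]) (intro continuous_intros)

lemma pw_extendable_pw_poly:
  assumes "pw_poly \<T> v" shows "pw_extendable \<T> v"
  unfolding pw_extendable_def
proof
  fix K assume "K \<in> \<T>"
  then obtain p where p: "real_polynomial_function p" "\<forall>x\<in>K. v x = p x"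
    using assms unfolding pw_poly_def by blast
  have "continuous_on K p"
    using p(1) by (simp add: continuous_on_polymonial_function real_polynomial_function_eq)
  with p(2) show "\<exists>g. continuous_on K g \<and> (\<forall>x\<in>interior K. v x = g x)"
    using interior_subset[of K] by blast
qed

lemma partial_eq:
  "(f has_derivative D) (at x) \<Longrightarrow> partial i f x = D (axis i 1)"
  unfolding partial_def by (drule frechet_derivative_at) simp

lemma real_polynomial_function_has_derivative:
  "real_polynomial_function p \<Longrightarrow> (p has_derivative frechet_derivative p (at x)) (at x)"
  by (simp add: differentiable_at_real_polynomial_function frechet_derivative_works[symmetric])

lemma partial_combination:
  assumes "real_polynomial_function p" "real_polynomial_function q"
  shows "partial i (\<lambda>x. c * p x + d * q x) = (\<lambda>x. c * partial i p x + d * partial i q x)"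
proof
  fix x
  have "((\<lambda>x. c * p x + d * q x) has_derivative (\<lambda>h. c * frechet_derivative p (at x) h
        + d * frechet_derivative q (at x) h)) (at x)"
    by (intro has_derivative_add has_derivative_mult_right
        real_polynomial_function_has_derivative assms)
  from partial_eq[OF this]
  show "partial i (\<lambda>x. c * p x + d * q x) x = c * partial i p x + d * partial i q x"
    by (simp add: partial_def)
qed

text \<open>Derivatives stay in the class of polynomials. Applied once and twice, this provides the
  continuous extensions of gradient and Hessian to a closed triangle.\<close>
lemma real_polynomial_function_partial:
  assumes "real_polynomial_function p"
  shows "real_polynomial_function (partial i p)"
  using assms
proof (induction rule: real_polynomial_function.induct)
  case (linear f)
  have "partial i f = (\<lambda>x. f (axis i 1))"
    using partial_eq[OF bounded_linear_imp_has_derivative[OF linear]] by blast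
  then show ?case by (simp add: real_polynomial_function.intros(2))
next
  case (const c)
  have "partial i (\<lambda>x. c) = (\<lambda>x. 0)"
    using partial_eq[OF has_derivative_const] by blast
  then show ?case by (simp add: real_polynomial_function.intros(2))
next
  case (add f g)
  have "partial i (\<lambda>x. f x + g x) = (\<lambda>x. partial i f x + partial i g x)"
    using partial_combination[OF add.hyps, of i 1 1] by simp
  then show ?case using add.IH by (simp add: real_polynomial_function.intros(3))
next
  case (mult f g)
  have "partial i (\<lambda>x. f x * g x) = (\<lambda>x. f x * partial i g x + partial i f x * g x)"
  proof
    fix x
    have "((\<lambda>x. f x * g x) has_derivative (\<lambda>h. f x * frechet_derivative g (at x) h
        + frechet_derivative f (at x) h * g x)) (at x)"
      by (intro has_derivative_mult real_polynomial_function_has_derivative mult.hyps)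
    from partial_eq[OF this]
    show "partial i (\<lambda>x. f x * g x) x = f x * partial i g x + partial i f x * g x"
      by (simp add: partial_def)
  qed
  then show ?case using mult by (simp add: real_polynomial_function.intros(3,4))
qed

text \<open>On an open set \<^const>\<open>partial\<close> depends only on the values there, even at points where the
  function is not differentiable: the predicate from which the derivative is selected is the same for
  both functions.\<close>
lemma partial_cong_open:
  assumes "open U" "x \<in> U" "\<And>y. y \<in> U \<Longrightarrow> f y = g y"
  shows "partial i f x = partial i g x"
proof -
  have "(f has_derivative D) (at x) \<longleftrightarrow> (g has_derivative D) (at x)" for D
    using has_derivative_transform_within_open[OF _ assms(1,2), of f D UNIV g]
      has_derivative_transform_within_open[OF _ assms(1,2), of g D UNIV f] assms(3) by auto
  then show ?thesis by (simp add: partial_def frechet_derivative_def)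
qed

lemma grad_cong_open:
  assumes "open U" "x \<in> U" "\<And>y. y \<in> U \<Longrightarrow> f y = g y"
  shows "grad f x = grad g x"
  unfolding grad_def using partial_cong_open[OF assms] by simp

lemma hess_cong_open:
  assumes "open U" "x \<in> U" "\<And>y. y \<in> U \<Longrightarrow> f y = g y"
  shows "hess f x = hess g x"
proof -
  have "partial j (partial i f) x = partial j (partial i g) x" for i j
    by (rule partial_cong_open[OF assms(1,2)]) (rule partial_cong_open[OF assms(1) _ assms(3)])
  then show ?thesis by (simp add: hess_def)
qed

lemma continuous_on_partial_poly:
  assumes "real_polynomial_function p" shows "continuous_on S (partial i p)"
  using real_polynomial_function_partial[OF assms]
  by (simp add: continuous_on_polymonial_function real_polynomial_function_eq)

lemma pw_extendable_grad:
  assumes "pw_poly \<T> v" shows "pw_extendable \<T> (grad v)"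
  unfolding pw_extendable_def
proof
  fix K assume "K \<in> \<T>"
  then obtain p where p: "real_polynomial_function p" "\<forall>x\<in>K. v x = p x"
    using assms unfolding pw_poly_def by blast
  have "continuous_on K (grad p)"
    unfolding grad_def [abs_def]
    by (intro continuous_on_vec_lambda continuous_on_partial_poly p)
  moreover have "grad v x = grad p x" if "x \<in> interior K" for x
    by (rule grad_cong_open[OF open_interior that]) (use p(2) interior_subset[of K] in blast)
  ultimately show "\<exists>g. continuous_on K g \<and> (\<forall>x\<in>interior K. grad v x = g x)" by blast
qed

lemma pw_extendable_hess:
  assumes "pw_poly \<T> v" shows "pw_extendable \<T> (hess v)"
  unfolding pw_extendable_def
proof
  fix K assume "K \<in> \<T>"
  then obtain p where p: "real_polynomial_function p" "\<forall>x\<in>K. v x = p x"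
    using assms unfolding pw_poly_def by blast
  have "continuous_on K (hess p)"
    unfolding hess_def [abs_def]
    by (intro continuous_on_vec_lambda continuous_on_partial_poly
        real_polynomial_function_partial p)
  moreover have "hess v x = hess p x" if "x \<in> interior K" for x
    by (rule hess_cong_open[OF open_interior that]) (use p(2) interior_subset[of K] in blast)
  ultimately show "\<exists>g. continuous_on K g \<and> (\<forall>x\<in>interior K. hess v x = g x)" by blast
qed

text \<open>Linearity of the derivatives is available only in the interiors of the triangles: on an edge, where
  one of the functions need not be differentiable, \<^const>\<open>partial\<close> has an arbitrary value.\<close>
lemma grad_hess_combination:
  assumes "pw_poly \<T> u" "pw_poly \<T> v" "K \<in> \<T>" "x \<in> interior K"
  shows "grad (\<lambda>x. c * u x + d * v x) x = c *\<^sub>R grad u x + d *\<^sub>R grad v x"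
    and "hess (\<lambda>x. c * u x + d * v x) x = c *\<^sub>R hess u x + d *\<^sub>R hess v x"
proof -
  obtain p where p: "real_polynomial_function p" "\<forall>x\<in>K. u x = p x"
    using assms(1,3) unfolding pw_poly_def by blast
  obtain q where q: "real_polynomial_function q" "\<forall>x\<in>K. v x = q x"
    using assms(2,3) unfolding pw_poly_def by blast
  let ?r = "\<lambda>x. c * p x + d * q x"
  note I = open_interior[of K] assms(4)
  have eq: "u y = p y" "v y = q y" "c * u y + d * v y = ?r y" if "y \<in> interior K" for y
    using that p q interior_subset[of K] by auto
  have "grad ?r x = c *\<^sub>R grad p x + d *\<^sub>R grad q x"
    using p(1) q(1) by (simp add: grad_def partial_combination vec_eq_iff)
  then show "grad (\<lambda>x. c * u x + d * v x) x = c *\<^sub>R grad u x + d *\<^sub>R grad v x"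
    using grad_cong_open[OF I, of "\<lambda>x. c * u x + d * v x" ?r] grad_cong_open[OF I, of u p]
      grad_cong_open[OF I, of v q] eq by simp
  have "hess ?r x = c *\<^sub>R hess p x + d *\<^sub>R hess q x"
    using p(1) q(1)
    by (simp add: hess_def partial_combination real_polynomial_function_partial vec_eq_iff)
  then show "hess (\<lambda>x. c * u x + d * v x) x = c *\<^sub>R hess u x + d *\<^sub>R hess v x"
    using hess_cong_open[OF I, of "\<lambda>x. c * u x + d * v x" ?r] hess_cong_open[OF I, of u p]
      hess_cong_open[OF I, of v q] eq by simp
qed

section \<open>Integrals over unions of triangles\<close>

lemma mesh_of_triangle:
  assumes "mesh_of \<Omega> \<T>" "K \<in> \<T>"
  shows "compact K" "convex K" "closure (interior K) = K"
proof -
  have K: "2 simplex K" using assms by (auto simp: mesh_of_def)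
  then show c: "compact K" "convex K"
    using simplex_imp_polytope[OF K] by (auto intro: polytope_imp_compact polytope_imp_convex)
  have "aff_dim K = 2" using aff_dim_simplex[OF K] .
  then have i: "interior K \<noteq> {}"
    using c(2) interior_rel_interior_gen[of K] rel_interior_eq_empty by fastforce
  show "closure (interior K) = K"
    using convex_closure_interior[OF c(2) i] compact_imp_closed[OF c(1)] by (simp add: closure_closed)
qed

text \<open>What the interiors of the triangles miss lies on finitely many boundaries of convex sets, so
  integrands need to be controlled only in the interiors.\<close>
lemma negligible_skeleton:
  assumes "mesh_of \<Omega> \<T>" "D \<subseteq> \<Union>\<T>"
  shows "negligible (D - (\<Union>K\<in>\<T>. interior K))"
proof -
  have "negligible (\<Union>K\<in>\<T>. frontier K)"
  proof (rule negligible_Union)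
    show "finite (frontier ` \<T>)"
      using assms(1) by (simp add: mesh_of_def triangulation_def)
    show "negligible t" if "t \<in> frontier ` \<T>" for t
      using that mesh_of_triangle(2)[OF assms(1)] negligible_convex_frontier by blast
  qed
  moreover have "D - (\<Union>K\<in>\<T>. interior K) \<subseteq> (\<Union>K\<in>\<T>. frontier K)"
  proof
    fix x assume x: "x \<in> D - (\<Union>K\<in>\<T>. interior K)"
    then obtain K where "K \<in> \<T>" "x \<in> K" using assms(2) by blast
    with x show "x \<in> (\<Union>K\<in>\<T>. frontier K)"
      using closure_subset[of K] unfolding frontier_def by blast
  qed
  ultimately show ?thesis by (rule negligible_subset)
qed

text \<open>A continuous extension to a compact triangle is integrable. The region \<open>D\<close> is the whole domain
  for the \<open>L\<^sup>2\<close> products and a single triangle for the Hessian term of the penalty form.\<close>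
lemma set_integrable_pw_extendable:
  fixes f :: "real^2 \<Rightarrow> real"
  assumes "mesh_of \<Omega> \<T>" "D \<in> sets lebesgue" "D \<subseteq> \<Union>\<T>" "pw_extendable \<T> f"
  shows "set_integrable lebesgue D f"
proof -
  let ?U = "\<Union>K\<in>\<T>. interior K"
  have fin: "finite \<T>" using assms(1) by (auto simp: mesh_of_def triangulation_def)
  have "set_integrable lebesgue (interior K) f" if K: "K \<in> \<T>" for K
  proof -
    obtain g where g: "continuous_on K g" "\<forall>x\<in>interior K. f x = g x"
      using assms(4) K unfolding pw_extendable_def by blast
    have "integrable lborel (\<lambda>x. indicator K x *\<^sub>R g x)"
      using borel_integrable_compact[OF mesh_of_triangle(1)[OF assms(1) K] g(1)] .
    then have "set_integrable lebesgue K g"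
      unfolding set_integrable_def
      using integrable_completion[OF borel_measurable_integrable] by blast
    then have "set_integrable lebesgue (interior K) g"
      by (rule set_integrable_subset) (auto simp: interior_subset)
    then show ?thesis
      using set_integrable_cong[of lebesgue lebesgue "interior K" "interior K" f g] g(2) by simp
  qed
  then have U: "set_integrable lebesgue ?U f"
    using fin by (intro set_integrable_UN) auto
  have "?U \<in> sets lebesgue" by (intro sets.finite_UN fin) auto
  then have "set_integrable lebesgue (D \<inter> ?U) f"
    using assms(2) by (intro set_integrable_subset[OF U]) auto
  then show ?thesis
    by (rule absolutely_integrable_spike_set)
      (rule negligible_subset[OF negligible_skeleton[OF assms(1,3)]], blast)+
qed

lemma set_integral_cong_interiors:
  fixes f g :: "real^2 \<Rightarrow> real"
  assumes "mesh_of \<Omega> \<T>" "D \<in> sets lebesgue" "D \<subseteq> \<Union>\<T>"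
    and "pw_extendable \<T> f" "pw_extendable \<T> g"
    and "\<And>K x. K \<in> \<T> \<Longrightarrow> x \<in> interior K \<Longrightarrow> f x = g x"
  shows "(LINT x:D|lebesgue. f x) = (LINT x:D|lebesgue. g x)"
proof -
  have "integral D f = integral D g"
    by (rule integral_spike[OF negligible_skeleton[OF assms(1,3)]]) (use assms(6) in auto)
  then show ?thesis
    using set_integrable_pw_extendable[OF assms(1-3)] assms(4,5)
    by (simp add: set_lebesgue_integral_eq_integral)
qed

text \<open>The form in which bilinearity of all area integrals is used: \<open>f\<close>, \<open>g\<close>, \<open>h\<close>, \<open>k\<close> stand for
  functions, gradients or Hessians, and \<open>k\<close> need be the linear combination of \<open>g\<close> and \<open>h\<close> only off the
  edges.\<close>
lemma set_integral_inner_combination: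
  fixes f g h k :: "real^2 \<Rightarrow> 'b::euclidean_space"
  assumes "mesh_of \<Omega> \<T>" "D \<in> sets lebesgue" "D \<subseteq> \<Union>\<T>"
    and ext: "pw_extendable \<T> f" "pw_extendable \<T> g" "pw_extendable \<T> h" "pw_extendable \<T> k"
    and eq: "\<And>K x. K \<in> \<T> \<Longrightarrow> x \<in> interior K \<Longrightarrow> k x = c *\<^sub>R g x + d *\<^sub>R h x"
  shows "(LINT x:D|lebesgue. f x \<bullet> k x)
       = c * (LINT x:D|lebesgue. f x \<bullet> g x) + d * (LINT x:D|lebesgue. f x \<bullet> h x)"
proof -
  note fg = pw_extendable_inner[OF ext(1,2)] and fh = pw_extendable_inner[OF ext(1,3)]
  have "(LINT x:D|lebesgue. f x \<bullet> k x)
      = (LINT x:D|lebesgue. c *\<^sub>R (f x \<bullet> g x) + d *\<^sub>R (f x \<bullet> h x))"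
    by (rule set_integral_cong_interiors[OF assms(1-3)
        pw_extendable_inner[OF ext(1,4)]
        pw_extendable_add[OF pw_extendable_scaleR[OF fg] pw_extendable_scaleR[OF fh]]])
      (simp add: eq inner_add_right)
  also have "\<dots> = (LINT x:D|lebesgue. c *\<^sub>R (f x \<bullet> g x)) + (LINT x:D|lebesgue. d *\<^sub>R (f x \<bullet> h x))"
    by (rule set_integral_add(2))
      (rule set_integrable_pw_extendable[OF assms(1-3)], rule pw_extendable_scaleR, rule fg fh)+
  finally show ?thesis by simp
qed

lemma polygonal_domain_in_mesh:
  assumes "polygonal_domain \<Omega>" "mesh_of \<Omega> \<T>"
  shows "\<Omega> \<in> sets lebesgue" "\<Omega> \<subseteq> \<Union>\<T>"
proof -
  have "open \<Omega>" using assms(1) unfolding polygonal_domain_def by blast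
  then show "\<Omega> \<in> sets lebesgue" by (intro sets_completionI_sets) auto
  have "\<Union>\<T> = closure \<Omega>" using assms(2) unfolding mesh_of_def by blast
  then show "\<Omega> \<subseteq> \<Union>\<T>" using closure_subset[of \<Omega>] by blast
qed

lemma L2_inner_commute: "L2_inner S u v = L2_inner S v u"
  by (simp add: L2_inner_def inner_commute)

lemma L2_inner_combination:
  assumes "polygonal_domain \<Omega>" "mesh_of \<Omega> \<T>" "pw_poly \<T> u" "pw_poly \<T> v" "pw_poly \<T> w"
  shows "L2_inner \<Omega> w (\<lambda>x. c * u x + d * v x) = c * L2_inner \<Omega> w u + d * L2_inner \<Omega> w v"
  unfolding L2_inner_def
  by (rule set_integral_inner_combination[OF assms(2) polygonal_domain_in_mesh[OF assms(1,2)]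
        assms(5,3,4)[THEN pw_extendable_pw_poly]
        pw_poly_combination[OF assms(3,4), THEN pw_extendable_pw_poly]]) simp

lemma L2_inner_grad_combination:
  assumes "polygonal_domain \<Omega>" "mesh_of \<Omega> \<T>" "pw_poly \<T> u" "pw_poly \<T> v" "pw_poly \<T> w"
  shows "L2_inner \<Omega> (grad w) (grad (\<lambda>x. c * u x + d * v x))
       = c * L2_inner \<Omega> (grad w) (grad u) + d * L2_inner \<Omega> (grad w) (grad v)"
  unfolding L2_inner_def
  by (rule set_integral_inner_combination[OF assms(2) polygonal_domain_in_mesh[OF assms(1,2)]
        assms(5,3,4)[THEN pw_extendable_grad]
        pw_poly_combination[OF assms(3,4), THEN pw_extendable_grad]])
      (rule grad_hess_combination(1)[OF assms(3,4)])

lemma Lp_norm_2_square: "(Lp_norm 2 S u)\<^sup>2 = L2_inner S u u"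
proof -
  let ?I = "LINT x:S|lebesgue. u x \<bullet> u x"
  have "0 \<le> ?I"
    unfolding set_lebesgue_integral_def by (rule integral_nonneg_AE) auto
  moreover have "Lp_norm 2 S u = ?I powr (1/2)"
    by (simp add: Lp_norm_def power2_norm_eq_inner)
  ultimately show ?thesis
    by (simp add: L2_inner_def powr_half_sqrt)
qed

lemma Lp_norm_4_power: "Lp_norm 4 S u ^ 4 = (LINT x:S|lebesgue. (u x) ^ 4)" for u :: "real^2 \<Rightarrow> real"
proof -
  let ?I = "LINT x:S|lebesgue. (u x) ^ 4"
  have "0 \<le> ?I"
    unfolding set_lebesgue_integral_def by (rule integral_nonneg_AE) auto
  moreover have "Lp_norm 4 S u = ?I powr (1/4)"
    by (simp add: Lp_norm_def)
  moreover have "(?I powr (1/4)) ^ 4 = ?I powr (real 4 * (1/4))"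
    by (cases "?I = 0") (simp_all add: powr_power)
  ultimately show ?thesis
    by simp
qed

section \<open>The interior penalty form\<close>

text \<open>Limits from inside a triangle are unique, since every point of it is a limit of interior points.\<close>
lemma nontrivial_within_triangle:
  assumes "mesh_of \<Omega> \<T>" "K \<in> \<T>" "x \<in> K"
  shows "at x within interior K \<noteq> bot"
proof (cases "x \<in> interior K")
  case True
  then show ?thesis by (simp only: at_within_open[OF _ open_interior] at_neq_bot not_False_eq_True)
next
  case False
  then have "x islimpt interior K"
    using mesh_of_triangle(3)[OF assms(1,2)] assms(3) unfolding closure_def by blast
  then show ?thesis using trivial_limit_within by blast
qed

text \<open>The one-sided value is that of the continuous extension, so the limit that defines it exists.\<close>
lemma
  assumes "mesh_of \<Omega> \<T>" "K \<in> \<T>" "pw_extendable \<T> f"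
  shows tendsto_side_value: "x \<in> K \<Longrightarrow> (f \<longlongrightarrow> side_value K f x) (at x within interior K)"
    and continuous_on_side_value: "continuous_on K (side_value K f)"
proof -
  obtain g where g: "continuous_on K g" "\<forall>x\<in>interior K. f x = g x"
    using assms(2,3) unfolding pw_extendable_def by blast
  have lim: "(f \<longlongrightarrow> g x) (at x within interior K)" if x: "x \<in> K" for x
  proof (rule Lim_transform_eventually)
    show "(g \<longlongrightarrow> g x) (at x within interior K)"
      using g(1) x tendsto_within_subset[OF _ interior_subset[of K]]
      unfolding continuous_on_def by blast
    show "\<forall>\<^sub>F y in at x within interior K. g y = f y"
      using g(2) by (simp add: eventually_at_filter)
  qed
  have sv: "side_value K f x = g x" if x: "x \<in> K" for x
    unfolding side_value_def
    by (rule tendsto_Lim[OF nontrivial_within_triangle[OF assms(1,2) x] lim[OF x]])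
  show "x \<in> K \<Longrightarrow> (f \<longlongrightarrow> side_value K f x) (at x within interior K)"
    using lim sv by simp
  show "continuous_on K (side_value K f)"
    using g(1) sv by (simp cong: continuous_on_cong)
qed

lemma side_value_combination:
  fixes f g h :: "real^2 \<Rightarrow> 'b::real_normed_vector"
  assumes "mesh_of \<Omega> \<T>" "K \<in> \<T>" "pw_extendable \<T> f" "pw_extendable \<T> g" "x \<in> K"
    and "\<And>y. y \<in> interior K \<Longrightarrow> h y = c *\<^sub>R f y + d *\<^sub>R g y"
  shows "side_value K h x = c *\<^sub>R side_value K f x + d *\<^sub>R side_value K g x"
  unfolding side_value_def[of K h]
proof (rule tendsto_Lim[OF nontrivial_within_triangle[OF assms(1,2,5)]],
    rule Lim_transform_eventually)
  show "((\<lambda>y. c *\<^sub>R f y + d *\<^sub>R g y) \<longlongrightarrow> c *\<^sub>R side_value K f x + d *\<^sub>R side_value K g x)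
      (at x within interior K)"
    by (intro tendsto_intros tendsto_side_value[OF assms(1,2)] assms)
  show "\<forall>\<^sub>F y in at x within interior K. c *\<^sub>R f y + d *\<^sub>R g y = h y"
    using assms(6) by (simp add: eventually_at_filter)
qed

lemma K_minus_mesh:
  assumes "e \<in> edges \<T>"
  shows "K_minus \<T> e \<in> \<T>" "e \<subseteq> K_minus \<T> e"
proof -
  have "K_minus \<T> e \<in> \<T> \<and> e edge_of K_minus \<T> e"
    unfolding K_minus_def by (rule someI_ex) (use assms in \<open>auto simp: edges_def\<close>)
  then show "K_minus \<T> e \<in> \<T>" "e \<subseteq> K_minus \<T> e"
    using edge_of_imp_subset by auto
qed

lemma K_plus_mesh:
  assumes "interior_edge \<T> e"
  shows "K_plus \<T> e \<in> \<T>" "e \<subseteq> K_plus \<T> e"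
proof -
  have "K_plus \<T> e \<in> \<T> \<and> e edge_of K_plus \<T> e \<and> K_plus \<T> e \<noteq> K_minus \<T> e"
    unfolding K_plus_def
    by (rule someI_ex) (use assms in \<open>unfold interior_edge_def, metis\<close>)
  then show "K_plus \<T> e \<in> \<T>" "e \<subseteq> K_plus \<T> e"
    using edge_of_imp_subset by auto
qed

lemma edge_is_segment:
  assumes "mesh_of \<Omega> \<T>" "e \<in> edges \<T>"
  obtains a b where "e = closed_segment a b"
proof -
  obtain K where K: "K \<in> \<T>" "e face_of K" "aff_dim e = 1"
    using assms(2) by (auto simp: edges_def edge_of_def)
  have "compact e" "convex e"
    using face_of_imp_compact[OF mesh_of_triangle(2,1)[OF assms(1) K(1)] K(2)]
      face_of_imp_convex[OF K(2)] mesh_of_triangle(2)[OF assms(1) K(1)] by auto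
  moreover have "e \<noteq> {}" using K(3) by auto
  moreover have "collinear e" using K(3) by (simp add: collinear_aff_dim)
  ultimately show ?thesis
    using compact_convex_collinear_segment that by metis
qed

text \<open>Continuity on \<open>e\<close> makes both integrals exist; an edge, being a compact convex set of dimension one,
  is a segment, so the parametrization selected in \<^const>\<open>edge_integral\<close> is one of \<open>e\<close>.\<close>
lemma edge_integral_combination:
  assumes "mesh_of \<Omega> \<T>" "e \<in> edges \<T>" "continuous_on e f" "continuous_on e g"
    and "\<And>x. x \<in> e \<Longrightarrow> h x = c * f x + d * g x"
  shows "edge_integral e h = c * edge_integral e f + d * edge_integral e g"
proof -
  obtain a b where ab: "(SOME (a, b). e = closed_segment a b) = (a, b)"
    by fastforce
  have e: "e = closed_segment a b"
  proof -
    obtain a' b' where "e = closed_segment a' b'"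
      by (rule edge_is_segment[OF assms(1,2)])
    then have "(\<lambda>(a, b). e = closed_segment a b) (a', b')" by simp
    from someI[where P = "\<lambda>(a, b). e = closed_segment a b", OF this]
    show ?thesis
      unfolding ab by simp
  qed
  have ei: "edge_integral e u
      = norm (b - a) * (LINT s:{0..1}|lebesgue. u (linepath a b s))" for u
    by (simp add: edge_integral_def ab)
  have in_e: "linepath a b s \<in> e" if "s \<in> {0..1}" for s
    using that linepath_image_01[of a b] e by auto
  have int: "set_integrable lebesgue {0..1} (\<lambda>s. u (linepath a b s))"
    if u: "continuous_on e u" for u :: "real^2 \<Rightarrow> real"
    by (rule absolutely_integrable_continuous_real)
      (rule continuous_on_compose2[OF u continuous_on_linepath], use in_e in auto)
  have "(LINT s:{0..1}|lebesgue. h (linepath a b s))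
      = (LINT s:{0..1}|lebesgue. c * f (linepath a b s) + d * g (linepath a b s))"
    by (rule set_lebesgue_integral_cong) (use assms(5) in_e in auto)
  also have "\<dots> = c * (LINT s:{0..1}|lebesgue. f (linepath a b s))
      + d * (LINT s:{0..1}|lebesgue. g (linepath a b s))"
    using int[OF assms(3)] int[OF assms(4)] by simp
  finally show ?thesis by (simp add: ei algebra_simps)
qed

text \<open>The selected normal and neighbouring triangles depend on the mesh and the edge only, not on the
  function. Jumps and averages are therefore fixed linear expressions in one-sided values.\<close>
lemma jump_dn_combination:
  assumes "mesh_of \<Omega> \<T>" "e \<in> edges \<T>" "pw_poly \<T> u" "pw_poly \<T> v" "x \<in> e"
  shows "jump_dn \<T> e (\<lambda>x. c * u x + d * v x) x = c * jump_dn \<T> e u x + d * jump_dn \<T> e v x"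
proof -
  have sv: "side_value K (grad (\<lambda>x. c * u x + d * v x)) x
      = c *\<^sub>R side_value K (grad u) x + d *\<^sub>R side_value K (grad v) x"
    if K: "K \<in> \<T>" "e \<subseteq> K" for K
    by (rule side_value_combination[OF assms(1) K(1) assms(3,4)[THEN pw_extendable_grad]])
      (use assms(5) K in \<open>auto intro: grad_hess_combination(1)[OF assms(3,4)]\<close>)
  show ?thesis
    using sv[OF K_minus_mesh[OF assms(2)]] sv[OF K_plus_mesh]
    by (auto simp: jump_dn_def Let_def inner_add_right inner_diff_right algebra_simps)
qed

lemma avg_dnn_combination:
  assumes "mesh_of \<Omega> \<T>" "e \<in> edges \<T>" "pw_poly \<T> u" "pw_poly \<T> v" "x \<in> e"
  shows "avg_dnn \<T> e (\<lambda>x. c * u x + d * v x) x = c * avg_dnn \<T> e u x + d * avg_dnn \<T> e v x"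
proof -
  have sv: "side_value K (hess (\<lambda>x. c * u x + d * v x)) x
      = c *\<^sub>R side_value K (hess u) x + d *\<^sub>R side_value K (hess v) x"
    if K: "K \<in> \<T>" "e \<subseteq> K" for K
    by (rule side_value_combination[OF assms(1) K(1) assms(3,4)[THEN pw_extendable_hess]])
      (use assms(5) K in \<open>auto intro: grad_hess_combination(2)[OF assms(3,4)]\<close>)
  show ?thesis
    using sv[OF K_minus_mesh[OF assms(2)]] sv[OF K_plus_mesh]
    by (auto simp: avg_dnn_def Let_def inner_add_right matrix_vector_mult_add_rdistrib
        scaleR_matrix_vector_assoc[symmetric] field_simps)
qed

lemma continuous_on_jump_dn:
  assumes "mesh_of \<Omega> \<T>" "e \<in> edges \<T>" "pw_poly \<T> v"
  shows "continuous_on e (jump_dn \<T> e v)"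
proof -
  have sv: "continuous_on e (side_value K (grad v))" if "K \<in> \<T>" "e \<subseteq> K" for K
    using continuous_on_side_value[OF assms(1) that(1) pw_extendable_grad[OF assms(3)]] that(2)
    by (rule continuous_on_subset)
  show ?thesis
    using sv[OF K_minus_mesh[OF assms(2)]] sv[OF K_plus_mesh]
    by (cases "interior_edge \<T> e")
      (auto simp: jump_dn_def [abs_def] Let_def intro!: continuous_intros)
qed

lemma continuous_on_avg_dnn:
  assumes "mesh_of \<Omega> \<T>" "e \<in> edges \<T>" "pw_poly \<T> v"
  shows "continuous_on e (avg_dnn \<T> e v)"
proof -
  have sv: "continuous_on e (\<lambda>x. side_value K (hess v) x *v n)" if "K \<in> \<T>" "e \<subseteq> K" for K n
  proof -
    have "continuous_on e (side_value K (hess v))"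
      using continuous_on_side_value[OF assms(1) that(1) pw_extendable_hess[OF assms(3)]] that(2)
      by (rule continuous_on_subset)
    then show ?thesis
      unfolding matrix_vector_mult_def by (intro continuous_intros)
  qed
  show ?thesis
    using sv[OF K_minus_mesh[OF assms(2)]] sv[OF K_plus_mesh]
    by (cases "interior_edge \<T> e")
      (auto simp: avg_dnn_def [abs_def] Let_def intro!: continuous_intros)
qed

text \<open>The two consistency sums trade places; the other two sums are symmetric term by term.\<close>
lemma a_IP_commute: "a_IP \<alpha> \<T> w v = a_IP \<alpha> \<T> v w"
  by (simp add: a_IP_def inner_commute mult.commute)

lemma a_IP_combination:
  assumes "mesh_of \<Omega> \<T>" "pw_poly \<T> u" "pw_poly \<T> v" "pw_poly \<T> w"
  shows "a_IP \<alpha> \<T> w (\<lambda>x. c * u x + d * v x) = c * a_IP \<alpha> \<T> w u + d * a_IP \<alpha> \<T> w v"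
proof -
  let ?z = "\<lambda>x. c * u x + d * v x"
  note J = continuous_on_jump_dn[OF assms(1)] and A = continuous_on_avg_dnn[OF assms(1)]
  have tri: "(LINT x:K|lebesgue. hess w x \<bullet> hess ?z x)
      = c * (LINT x:K|lebesgue. hess w x \<bullet> hess u x) + d * (LINT x:K|lebesgue. hess w x \<bullet> hess v x)"
    if K: "K \<in> \<T>" for K
  proof (rule set_integral_inner_combination[OF assms(1) _ _ assms(4,2,3)[THEN pw_extendable_hess]
        pw_poly_combination[OF assms(2,3), THEN pw_extendable_hess]])
    show "K \<in> sets lebesgue"
      using compact_imp_closed[OF mesh_of_triangle(1)[OF assms(1) K]] by auto
    show "K \<subseteq> \<Union>\<T>" using K by auto
  qed (rule grad_hess_combination(2)[OF assms(2,3)])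
  have e1: "edge_integral e (\<lambda>x. avg_dnn \<T> e w x * jump_dn \<T> e ?z x)
      = c * edge_integral e (\<lambda>x. avg_dnn \<T> e w x * jump_dn \<T> e u x)
      + d * edge_integral e (\<lambda>x. avg_dnn \<T> e w x * jump_dn \<T> e v x)" if e: "e \<in> edges \<T>" for e
    by (rule edge_integral_combination[OF assms(1) e])
      (auto intro!: continuous_on_mult J A assms e
        simp: jump_dn_combination[OF assms(1) e assms(2,3)] algebra_simps)
  have e2: "edge_integral e (\<lambda>x. avg_dnn \<T> e ?z x * jump_dn \<T> e w x)
      = c * edge_integral e (\<lambda>x. avg_dnn \<T> e u x * jump_dn \<T> e w x)
      + d * edge_integral e (\<lambda>x. avg_dnn \<T> e v x * jump_dn \<T> e w x)" if e: "e \<in> edges \<T>" for e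
    by (rule edge_integral_combination[OF assms(1) e])
      (auto intro!: continuous_on_mult J A assms e
        simp: avg_dnn_combination[OF assms(1) e assms(2,3)] algebra_simps)
  have e3: "1 / diameter e * edge_integral e (\<lambda>x. jump_dn \<T> e w x * jump_dn \<T> e ?z x)
      = c * (1 / diameter e * edge_integral e (\<lambda>x. jump_dn \<T> e w x * jump_dn \<T> e u x))
      + d * (1 / diameter e * edge_integral e (\<lambda>x. jump_dn \<T> e w x * jump_dn \<T> e v x))"
    if e: "e \<in> edges \<T>" for e
  proof -
    have "edge_integral e (\<lambda>x. jump_dn \<T> e w x * jump_dn \<T> e ?z x)
        = c * edge_integral e (\<lambda>x. jump_dn \<T> e w x * jump_dn \<T> e u x)
        + d * edge_integral e (\<lambda>x. jump_dn \<T> e w x * jump_dn \<T> e v x)"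
      by (rule edge_integral_combination[OF assms(1) e])
        (auto intro!: continuous_on_mult J A assms e
          simp: jump_dn_combination[OF assms(1) e assms(2,3)] algebra_simps)
    then show ?thesis by (simp add: add_divide_distrib)
  qed
  show ?thesis
    unfolding a_IP_def
    by (simp only: tri e1 e2 e3 sum.distrib sum_distrib_left[symmetric] cong: sum.cong)
      (simp only: algebra_simps)
qed

section \<open>The energy identity\<close>

lemma fe_space_combination:
  assumes "u \<in> fe_space k \<Omega> \<T>" "v \<in> fe_space k \<Omega> \<T>"
  shows "(\<lambda>x. c * u x + d * v x) \<in> fe_space k \<Omega> \<T>"
proof -
  have "poly_on k K (\<lambda>x. c * u x + d * v x)" if K: "K \<in> \<T>" for K
  proof -
    obtain p :: "nat \<Rightarrow> nat \<Rightarrow> real" where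
      p: "\<forall>x\<in>K. u x = (\<Sum>i\<le>k. \<Sum>j\<le>k - i. p i j * (x $ 1) ^ i * (x $ 2) ^ j)"
      using assms(1) K unfolding fe_space_def poly_on_def by blast
    obtain q :: "nat \<Rightarrow> nat \<Rightarrow> real" where
      q: "\<forall>x\<in>K. v x = (\<Sum>i\<le>k. \<Sum>j\<le>k - i. q i j * (x $ 1) ^ i * (x $ 2) ^ j)"
      using assms(2) K unfolding fe_space_def poly_on_def by blast
    show ?thesis
      unfolding poly_on_def
      by (rule exI[of _ "\<lambda>i j. c * p i j + d * q i j"])
        (use p q in \<open>simp add: sum_distrib_left sum.distrib[symmetric] algebra_simps\<close>)
  qed
  then show ?thesis
    using assms by (auto simp: fe_space_def intro!: continuous_intros)
qed

text \<open>The difference quotient \<open>(u - v) / \<tau>\<close> is a linear combination of \<open>u\<close> and \<open>v\<close>. By symmetry, linearity in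
  the second argument along \<open>u\<close>, \<open>v\<close> expands the form on it completely. The first argument is restricted
  to piecewise polynomials because integrability, and with it linearity, is
  available for these.\<close>
lemma quadratic_form_difference:
  fixes B :: "(real^2 \<Rightarrow> real) \<Rightarrow> (real^2 \<Rightarrow> real) \<Rightarrow> real"
  assumes sym: "\<And>f g. B f g = B g f"
    and lin: "\<And>w c d. pw_poly \<T> w \<Longrightarrow> B w (\<lambda>x. c * u x + d * v x) = c * B w u + d * B w v"
    and uv: "pw_poly \<T> u" "pw_poly \<T> v" and "\<tau> \<noteq> 0"
  shows "\<tau>\<^sup>2 * B (\<lambda>x. (u x - v x) / \<tau>) (\<lambda>x. (u x - v x) / \<tau>) = B u u - 2 * B u v + B v v"
    and "\<tau> * B u (\<lambda>x. (u x - v x) / \<tau>) = B u u - B u v"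
    and "\<tau> * B v (\<lambda>x. (u x - v x) / \<tau>) = B u v - B v v"
proof -
  let ?d = "\<lambda>x. (u x - v x) / \<tau>"
  have d: "?d = (\<lambda>x. (1/\<tau>) * u x + (-1/\<tau>) * v x)"
    by (simp add: diff_divide_distrib)
  have Bd: "\<tau> * B w ?d = B w u - B w v" if "pw_poly \<T> w" for w
    unfolding d lin[OF that] using \<open>\<tau> \<noteq> 0\<close> by (simp add: field_simps)
  have "pw_poly \<T> ?d" unfolding d by (rule pw_poly_combination[OF uv])
  from Bd[OF this] have "\<tau>\<^sup>2 * B ?d ?d = \<tau> * B u ?d - \<tau> * B v ?d"
    unfolding sym[of ?d u] sym[of ?d v] power2_eq_square
    by (simp only: mult.assoc right_diff_distrib)
  with Bd[OF uv(1)] Bd[OF uv(2)] sym[of v u]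
  show "\<tau>\<^sup>2 * B ?d ?d = B u u - 2 * B u v + B v v"
    and "\<tau> * B u ?d = B u u - B u v" and "\<tau> * B v ?d = B u v - B v v"
    by auto
qed

lemma pw_extendable_mult:
  fixes f g :: "real^2 \<Rightarrow> real"
  assumes "pw_extendable \<T> f" "pw_extendable \<T> g"
  shows "pw_extendable \<T> (\<lambda>x. f x * g x)"
  using pw_extendable_inner[OF assms] by simp

text \<open>The cubic term, implicit in time, is the derivative of a convex quartic, and the remainder of the
  discrete chain rule is a sum of two squares:
  \<open>u\<^sup>3(u - v) = (u\<^sup>4 - v\<^sup>4) / 4 + (u\<^sup>2 - v\<^sup>2)\<^sup>2 / 4 + u\<^sup>2(u - v)\<^sup>2 / 2\<close>.\<close>
lemma cubic_term_identity:
  assumes "polygonal_domain \<Omega>" "mesh_of \<Omega> \<T>" "pw_poly \<T> u" "pw_poly \<T> v" "\<tau> \<noteq> 0"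
  shows "\<tau> * L2_inner \<Omega> (\<lambda>x. u x ^ 3 + k * u x) (\<lambda>x. (u x - v x) / \<tau>)
    = 1/4 * Lp_norm 4 \<Omega> u ^ 4 - 1/4 * Lp_norm 4 \<Omega> v ^ 4
      + \<tau>\<^sup>2 * (1/4 * (Lp_norm 2 \<Omega> (\<lambda>x. ((u x)\<^sup>2 - (v x)\<^sup>2) / \<tau>))\<^sup>2
             + 1/2 * (Lp_norm 2 \<Omega> (\<lambda>x. u x * ((u x - v x) / \<tau>)))\<^sup>2)
      + k * (L2_inner \<Omega> u u - L2_inner \<Omega> u v)"
proof -
  let ?I = "\<lambda>f::real^2 \<Rightarrow> real. LINT x:\<Omega>|lebesgue. f x"
  let ?d = "\<lambda>x. (u x - v x) / \<tau>" and ?s = "\<lambda>x. ((u x)\<^sup>2 - (v x)\<^sup>2) / \<tau>"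
  note ext = assms(3,4)[THEN pw_extendable_pw_poly]
  have d: "?d = (\<lambda>x. (1/\<tau>) *\<^sub>R u x + (-1/\<tau>) *\<^sub>R v x)"
    and s: "?s = (\<lambda>x. (1/\<tau>) *\<^sub>R (u x * u x) + (-1/\<tau>) *\<^sub>R (v x * v x))"
    by (simp_all add: diff_divide_distrib power2_eq_square)
  have dext: "pw_extendable \<T> ?d" and sext: "pw_extendable \<T> ?s"
    unfolding d s by (intro pw_extendable_add pw_extendable_scaleR pw_extendable_mult ext)+
  note si = set_integrable_pw_extendable[OF assms(2) polygonal_domain_in_mesh[OF assms(1,2)]]
  have int: "set_integrable lebesgue \<Omega> (\<lambda>x. u x ^ 4)" "set_integrable lebesgue \<Omega> (\<lambda>x. v x ^ 4)"
    "set_integrable lebesgue \<Omega> (\<lambda>x. ?s x * ?s x)"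
    "set_integrable lebesgue \<Omega> (\<lambda>x. (u x * ?d x) * (u x * ?d x))"
    "set_integrable lebesgue \<Omega> (\<lambda>x. u x * u x)" "set_integrable lebesgue \<Omega> (\<lambda>x. u x * v x)"
    unfolding power4_eq_xxxx by (intro si pw_extendable_mult ext dext sext)+
  have pt: "\<tau> * ((u x ^ 3 + k * u x) * ?d x)
     = 1/4 * u x ^ 4 - 1/4 * v x ^ 4 + (\<tau>\<^sup>2/4 * (?s x * ?s x) + \<tau>\<^sup>2/2 * ((u x * ?d x) * (u x * ?d x)))
       + (k * (u x * u x) - k * (u x * v x))" for x
  proof -
    have "\<tau> * ?d x = u x - v x" "\<tau>\<^sup>2 * (?s x * ?s x) = ((u x)\<^sup>2 - (v x)\<^sup>2)\<^sup>2"
      "\<tau>\<^sup>2 * ((u x * ?d x) * (u x * ?d x)) = (u x * (u x - v x))\<^sup>2"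
      using assms(5) by (auto simp: power2_eq_square)
    then show ?thesis by algebra
  qed
  have "\<tau> * ?I (\<lambda>x. (u x ^ 3 + k * u x) * ?d x) = ?I (\<lambda>x. \<tau> * ((u x ^ 3 + k * u x) * ?d x))"
    by (rule set_integral_mult_right[symmetric])
  also have "\<dots> = ?I (\<lambda>x. 1/4 * u x ^ 4 - 1/4 * v x ^ 4
      + (\<tau>\<^sup>2/4 * (?s x * ?s x) + \<tau>\<^sup>2/2 * ((u x * ?d x) * (u x * ?d x)))
      + (k * (u x * u x) - k * (u x * v x)))"
    unfolding pt ..
  also have "\<dots> = 1/4 * ?I (\<lambda>x. u x ^ 4) - 1/4 * ?I (\<lambda>x. v x ^ 4)
      + (\<tau>\<^sup>2/4 * ?I (\<lambda>x. ?s x * ?s x) + \<tau>\<^sup>2/2 * ?I (\<lambda>x. (u x * ?d x) * (u x * ?d x)))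
      + (k * ?I (\<lambda>x. u x * u x) - k * ?I (\<lambda>x. u x * v x))"
    by (simp only: set_integral_add set_integral_diff set_integral_mult_right
        set_integrable_mult_right int)
  finally show ?thesis
    unfolding Lp_norm_2_square Lp_norm_4_power L2_inner_def inner_real_def
    by (simp add: field_simps)
qed

text \<open>The concave gradient term is evaluated at the old value \<open>v\<close> and every other term at the new
  value \<open>u\<close>. With this splitting each part of the energy contributes its increment and a remainder that
  is built from differences of \<open>u\<close> and \<open>v\<close>.\<close>
lemma energy_step:
  assumes "polygonal_domain \<Omega>" "mesh_of \<Omega> \<T>" "\<tau> > 0"
    and u: "u \<in> Z_space \<Omega> \<T>" and v: "v \<in> Z_space \<Omega> \<T>" and \<mu>: "\<mu> \<in> V_space \<Omega> \<T>"
    and eq1: "\<And>\<nu>. \<nu> \<in> V_space \<Omega> \<T> \<Longrightarrow>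
      L2_inner \<Omega> (\<lambda>x. (u x - v x) / \<tau>) \<nu> + L2_inner \<Omega> (grad \<mu>) (grad \<nu>) = 0"
    and eq2: "\<And>\<psi>. \<psi> \<in> Z_space \<Omega> \<T> \<Longrightarrow>
      a_IP \<alpha> \<T> u \<psi> + L2_inner \<Omega> (\<lambda>x. u x ^ 3 + (1 - \<epsilon>) * u x) \<psi>
      - 2 * L2_inner \<Omega> (grad v) (grad \<psi>) - L2_inner \<Omega> \<mu> \<psi> = 0"
  defines "d \<equiv> \<lambda>x. (u x - v x) / \<tau>"
  shows "energy \<alpha> \<epsilon> \<Omega> \<T> u + \<tau> * (Lp_norm 2 \<Omega> (grad \<mu>))\<^sup>2
    + \<tau>\<^sup>2 * ((1 - \<epsilon>) / 2 * (Lp_norm 2 \<Omega> d)\<^sup>2 + (Lp_norm 2 \<Omega> (grad d))\<^sup>2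
        + 1/4 * (Lp_norm 2 \<Omega> (\<lambda>x. ((u x)\<^sup>2 - (v x)\<^sup>2) / \<tau>))\<^sup>2
        + 1/2 * (Lp_norm 2 \<Omega> (\<lambda>x. u x * d x))\<^sup>2 + 1/2 * a_IP \<alpha> \<T> d d)
    = energy \<alpha> \<epsilon> \<Omega> \<T> v"
proof -
  have \<tau>: "\<tau> \<noteq> 0" using assms(3) by simp
  have pu: "pw_poly \<T> u" and pv: "pw_poly \<T> v"
    using u v pw_poly_fe_space unfolding Z_space_def by blast+
  have d: "d = (\<lambda>x. (1/\<tau>) * u x + (-1/\<tau>) * v x)"
    by (simp add: d_def diff_divide_distrib)
  have "d \<in> Z_space \<Omega> \<T>"
    using u v unfolding d Z_space_def by (rule fe_space_combination)
  \<comment> \<open>The two equations, tested with \<open>d\<close> and \<open>\<mu>\<close>, are added so that \<open>(\<mu>, d)\<close> drops out.\<close>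
  from eq2[OF this] eq1[OF \<mu>] have tested:
    "\<tau> * a_IP \<alpha> \<T> u d + \<tau> * L2_inner \<Omega> (\<lambda>x. u x ^ 3 + (1 - \<epsilon>) * u x) d
      - 2 * (\<tau> * L2_inner \<Omega> (grad v) (grad d)) + \<tau> * L2_inner \<Omega> (grad \<mu>) (grad \<mu>) = 0"
    unfolding d_def[symmetric] L2_inner_commute[of \<Omega> \<mu> d] by algebra
  have a: "\<tau>\<^sup>2 * a_IP \<alpha> \<T> d d = a_IP \<alpha> \<T> u u - 2 * a_IP \<alpha> \<T> u v + a_IP \<alpha> \<T> v v"
      "\<tau> * a_IP \<alpha> \<T> u d = a_IP \<alpha> \<T> u u - a_IP \<alpha> \<T> u v"
    unfolding d_def
    by (rule quadratic_form_difference[OF a_IP_commute _ pu pv \<tau>],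
        erule a_IP_combination[OF assms(2) pu pv])+
  have l: "\<tau>\<^sup>2 * L2_inner \<Omega> d d = L2_inner \<Omega> u u - 2 * L2_inner \<Omega> u v + L2_inner \<Omega> v v"
    unfolding d_def
    by (rule quadratic_form_difference[OF L2_inner_commute _ pu pv \<tau>],
        erule L2_inner_combination[OF assms(1,2) pu pv])
  have g: "\<tau>\<^sup>2 * L2_inner \<Omega> (grad d) (grad d) = L2_inner \<Omega> (grad u) (grad u)
        - 2 * L2_inner \<Omega> (grad u) (grad v) + L2_inner \<Omega> (grad v) (grad v)"
      "\<tau> * L2_inner \<Omega> (grad v) (grad d) = L2_inner \<Omega> (grad u) (grad v) - L2_inner \<Omega> (grad v) (grad v)"
    unfolding d_def
    by (rule quadratic_form_difference[of "\<lambda>f g. L2_inner \<Omega> (grad f) (grad g)",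
          OF L2_inner_commute _ pu pv \<tau>],
        erule L2_inner_grad_combination[OF assms(1,2) pu pv])+
  have c: "\<tau> * L2_inner \<Omega> (\<lambda>x. u x ^ 3 + (1 - \<epsilon>) * u x) d
    = 1/4 * Lp_norm 4 \<Omega> u ^ 4 - 1/4 * Lp_norm 4 \<Omega> v ^ 4
      + \<tau>\<^sup>2 * (1/4 * (Lp_norm 2 \<Omega> (\<lambda>x. ((u x)\<^sup>2 - (v x)\<^sup>2) / \<tau>))\<^sup>2
             + 1/2 * (Lp_norm 2 \<Omega> (\<lambda>x. u x * d x))\<^sup>2)
      + (1 - \<epsilon>) * (L2_inner \<Omega> u u - L2_inner \<Omega> u v)"
    unfolding d_def by (rule cubic_term_identity[OF assms(1,2) pu pv \<tau>])
  have split: "\<tau>\<^sup>2 * ((1 - \<epsilon>) / 2 * L + G + 1/4 * S + 1/2 * T + 1/2 * A)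
    = (1 - \<epsilon>) / 2 * (\<tau>\<^sup>2 * L) + \<tau>\<^sup>2 * G + \<tau>\<^sup>2 * (1/4 * S + 1/2 * T) + 1/2 * (\<tau>\<^sup>2 * A)"
    for L G S T A :: real
    by (simp add: field_simps)
  show ?thesis
    using tested[unfolded a c g]
    unfolding energy_def split a g Lp_norm_2_square[of \<Omega> "grad u"] Lp_norm_2_square[of \<Omega> "grad v"]
      Lp_norm_2_square[of \<Omega> "grad d"] Lp_norm_2_square[of \<Omega> "grad \<mu>"]
      Lp_norm_2_square[of \<Omega> u] Lp_norm_2_square[of \<Omega> v] Lp_norm_2_square[of \<Omega> d] l
    by (simp add: field_simps)
qed

theorem lemma3p5:
  fixes \<Omega> :: "(real^2) set" and \<T> :: "(real^2) set set"
    and \<tau> \<epsilon> \<alpha> h \<sigma> :: real and M :: nat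
    and \<phi>\<^sub>0 :: "real^2 \<Rightarrow> real" and \<phi> \<mu> :: "nat \<Rightarrow> real^2 \<Rightarrow> real"
  assumes "polygonal_domain \<Omega>"
    and "mesh_of \<Omega> \<T>" and "locally_quasi_uniform \<sigma> \<T>" and "h = mesh_size \<T>" and "h > 0"
    and "\<tau> > 0" and "\<epsilon> < 1" and "\<alpha> \<ge> 1"
    and "\<phi>\<^sub>0 \<in> sobolev_H 4 \<Omega>" and "continuous_on \<Omega> \<phi>\<^sub>0"
    and "neumann_zero \<Omega> \<phi>\<^sub>0" and "neumann_zero \<Omega> (laplacian \<phi>\<^sub>0)"
    and "ritz_projection \<alpha> \<epsilon> \<Omega> \<T> \<phi>\<^sub>0 (\<phi> 0)"
    and "\<And>m. 1 \<le> m \<Longrightarrow> m \<le> M \<Longrightarrow> \<phi> m \<in> Z_space \<Omega> \<T>"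
    and "\<And>m. 1 \<le> m \<Longrightarrow> m \<le> M \<Longrightarrow> \<mu> m \<in> V_space \<Omega> \<T>"
    and "\<And>m \<nu>. 1 \<le> m \<Longrightarrow> m \<le> M \<Longrightarrow> \<nu> \<in> V_space \<Omega> \<T> \<Longrightarrow>
           L2_inner \<Omega> (\<delta> \<tau> \<phi> m) \<nu> + L2_inner \<Omega> (grad (\<mu> m)) (grad \<nu>) = 0"
    and "\<And>m \<psi>. 1 \<le> m \<Longrightarrow> m \<le> M \<Longrightarrow> \<psi> \<in> Z_space \<Omega> \<T> \<Longrightarrow>
           a_IP \<alpha> \<T> (\<phi> m) \<psi> + L2_inner \<Omega> (\<lambda>x. (\<phi> m x) ^ 3 + (1 - \<epsilon>) * \<phi> m x) \<psi>
           - 2 * L2_inner \<Omega> (grad (\<phi> (m - 1))) (grad \<psi>) - L2_inner \<Omega> (\<mu> m) \<psi> = 0"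
  shows "\<forall>l. 1 \<le> l \<and> l \<le> M \<longrightarrow>
    energy \<alpha> \<epsilon> \<Omega> \<T> (\<phi> l)
    + \<tau> * (\<Sum>m=1..l. (Lp_norm 2 \<Omega> (grad (\<mu> m)))\<^sup>2)
    + \<tau>\<^sup>2 * (\<Sum>m=1..l.
        (1 - \<epsilon>) / 2 * (Lp_norm 2 \<Omega> (\<delta> \<tau> \<phi> m))\<^sup>2
        + (Lp_norm 2 \<Omega> (grad (\<delta> \<tau> \<phi> m)))\<^sup>2
        + 1/4 * (Lp_norm 2 \<Omega> (\<delta> \<tau> (\<lambda>k x. (\<phi> k x)\<^sup>2) m))\<^sup>2
        + 1/2 * (Lp_norm 2 \<Omega> (\<lambda>x. \<phi> m x * \<delta> \<tau> \<phi> m x))\<^sup>2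
        + 1/2 * a_IP \<alpha> \<T> (\<delta> \<tau> \<phi> m) (\<delta> \<tau> \<phi> m))
    = energy \<alpha> \<epsilon> \<Omega> \<T> (\<phi> 0)"
proof -
  \<comment> \<open>At \<open>m = 0\<close> this is part of the definition of the Ritz projection.\<close>
  have Z: "\<phi> m \<in> Z_space \<Omega> \<T>" if "m \<le> M" for m
    using assms(13) assms(14)[of m] that unfolding ritz_projection_def by (cases "m = 0") auto
  have step: "energy \<alpha> \<epsilon> \<Omega> \<T> (\<phi> m) + \<tau> * (Lp_norm 2 \<Omega> (grad (\<mu> m)))\<^sup>2
    + \<tau>\<^sup>2 * ((1 - \<epsilon>) / 2 * (Lp_norm 2 \<Omega> (\<delta> \<tau> \<phi> m))\<^sup>2
        + (Lp_norm 2 \<Omega> (grad (\<delta> \<tau> \<phi> m)))\<^sup>2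
        + 1/4 * (Lp_norm 2 \<Omega> (\<delta> \<tau> (\<lambda>k x. (\<phi> k x)\<^sup>2) m))\<^sup>2
        + 1/2 * (Lp_norm 2 \<Omega> (\<lambda>x. \<phi> m x * \<delta> \<tau> \<phi> m x))\<^sup>2
        + 1/2 * a_IP \<alpha> \<T> (\<delta> \<tau> \<phi> m) (\<delta> \<tau> \<phi> m))
    = energy \<alpha> \<epsilon> \<Omega> \<T> (\<phi> (m - 1))" if m: "1 \<le> m" "m \<le> M" for m
  proof -
    have "m - 1 \<le> M" using m by simp
    from energy_step[OF assms(1,2,6) Z[OF m(2)] Z[OF this] assms(15)[OF m]
        assms(16)[OF m, unfolded \<delta>_def[abs_def]] assms(17)[OF m]]
    show ?thesis unfolding \<delta>_def[abs_def] .
  qed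
  have telescope: "energy \<alpha> \<epsilon> \<Omega> \<T> (\<phi> l)
    + \<tau> * (\<Sum>m=1..l. (Lp_norm 2 \<Omega> (grad (\<mu> m)))\<^sup>2)
    + \<tau>\<^sup>2 * (\<Sum>m=1..l.
        (1 - \<epsilon>) / 2 * (Lp_norm 2 \<Omega> (\<delta> \<tau> \<phi> m))\<^sup>2
        + (Lp_norm 2 \<Omega> (grad (\<delta> \<tau> \<phi> m)))\<^sup>2
        + 1/4 * (Lp_norm 2 \<Omega> (\<delta> \<tau> (\<lambda>k x. (\<phi> k x)\<^sup>2) m))\<^sup>2
        + 1/2 * (Lp_norm 2 \<Omega> (\<lambda>x. \<phi> m x * \<delta> \<tau> \<phi> m x))\<^sup>2
        + 1/2 * a_IP \<alpha> \<T> (\<delta> \<tau> \<phi> m) (\<delta> \<tau> \<phi> m))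
    = energy \<alpha> \<epsilon> \<Omega> \<T> (\<phi> 0)" if "l \<le> M" for l
    using that
  proof (induction l)
    case 0
    show ?case by simp
  next
    case (Suc l)
    then have IH: "l \<le> M" "1 \<le> Suc l" by auto
    have split: "(\<Sum>m=1..Suc l. f m) = (\<Sum>m=1..l. f m) + f (Suc l)" for f :: "nat \<Rightarrow> real"
      by simp
    show ?case
      unfolding split distrib_left using Suc.IH[OF IH(1)] step[OF IH(2) Suc.prems]
      unfolding diff_Suc_1 distrib_left by linarith
  qed
  then show ?thesis by blast
qed

end
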